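(* Let $k$ be a field, $<$ a monomial preorder on $k[X]=k[x_1,\dots,x_n]$, and $I$ a homogeneous ideal in $k[X]$. Then $$HP_{k[X]/I}(z)=HP_{k[X]/L_<(I)}(z).$$
   Context: "Homogeneous" is with respect to the standard grading $\deg x_i=1$. For $a\in\mathbb{N}^n$ write $x^a=x_1^{\alpha_1}\cdots x_n^{\alpha_n}$. A weak order on a set is a strict partial order for which incomparability is an equivalence relation. A monomial preorder on $k[X]$ is a weak order $<$ on the monomials such that for all $a,b,c\in\mathbb{N}^n$: $x^a<x^b$ if and only if $x^ax^c<x^bx^c$. For $f=\sum c_ax^a\in k[X]$, the leading part $L_<(f)$ is the sum of those terms $c_ax^a$ ($c_a\ne0$) such that no monomial $x^b$ occurring in $f$ satisfies $x^a<x^b$. For $I\subseteq k[X]$, $L_<(I)$ is the ideal of $k[X]$ generated by all $L_<(f)$, $f\in I$; for homogeneous $I$ it is again homogeneous. For a standard graded $k$-algebra $R$ with graded components $R_t$, $HP_R(z)=\sum_{t\ge0}(\dim_kR_t)z^t$. *)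

theory Defs
  imports
    "Jordan_Normal_Form.VS_Connect"
    "HOL-Algebra.QuotRing"
    "HOL-Library.Poly_Mapping"
    "HOL-Computational_Algebra.Formal_Power_Series"
begin

hide_const (open) Multiset.mult Polynomial.smult Modules.module

text \<open>
  The variables are indexed by a finite type \<open>'n\<close>. An exponent vector is an element of
  \<^typ>\<open>'n \<Rightarrow>\<^sub>0 nat\<close>, and the monomial \<open>x\<^sup>a\<close> is identified with its exponent vector \<open>a\<close>, so that
  multiplication of monomials is addition of exponent vectors.
\<close>

type_synonym 'n expo = "'n \<Rightarrow>\<^sub>0 nat"

type_synonym ('n, 'k) mpoly = "'n expo \<Rightarrow>\<^sub>0 'k"

abbreviation polyring :: "('n, 'k::comm_ring_1) mpoly ring" where
  "polyring \<equiv> class_ring"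

definition expo_deg :: "'n::finite expo \<Rightarrow> nat" where
  "expo_deg a = (\<Sum>i\<in>UNIV. Poly_Mapping.lookup a i)"

definition homogeneous_polys :: "nat \<Rightarrow> ('n::finite, 'k::zero) mpoly set" where
  "homogeneous_polys t = {f. \<forall>a\<in>Poly_Mapping.keys f. expo_deg a = t}"

definition homogeneous_component ::
    "nat \<Rightarrow> ('n::finite, 'k::comm_monoid_add) mpoly \<Rightarrow> ('n, 'k) mpoly" where
  "homogeneous_component t f =
     (\<Sum>a | a \<in> Poly_Mapping.keys f \<and> expo_deg a = t.
        Poly_Mapping.single a (Poly_Mapping.lookup f a))"

definition homogeneous_ideal :: "('n::finite, 'k::comm_ring_1) mpoly set \<Rightarrow> bool" where
  "homogeneous_ideal I \<longleftrightarrow>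
     ideal I polyring \<and> (\<forall>f\<in>I. \<forall>t. homogeneous_component t f \<in> I)"

definition weak_order :: "('a \<Rightarrow> 'a \<Rightarrow> bool) \<Rightarrow> bool" where
  "weak_order r \<longleftrightarrow> irreflp r \<and> transp r \<and> equivp (\<lambda>a b. \<not> r a b \<and> \<not> r b a)"

definition monomial_preorder :: "('n expo \<Rightarrow> 'n expo \<Rightarrow> bool) \<Rightarrow> bool" where
  "monomial_preorder lt \<longleftrightarrow> weak_order lt \<and> (\<forall>a b c. lt a b \<longleftrightarrow> lt (a + c) (b + c))"

definition leading_part ::
    "('n expo \<Rightarrow> 'n expo \<Rightarrow> bool) \<Rightarrow> ('n, 'k::comm_monoid_add) mpoly \<Rightarrow> ('n, 'k) mpoly" where
  "leading_part lt f =
     (\<Sum>a | a \<in> Poly_Mapping.keys f \<and> (\<forall>b\<in>Poly_Mapping.keys f. \<not> lt a b).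
        Poly_Mapping.single a (Poly_Mapping.lookup f a))"

definition leading_ideal ::
    "('n expo \<Rightarrow> 'n expo \<Rightarrow> bool) \<Rightarrow> ('n, 'k::comm_ring_1) mpoly set \<Rightarrow> ('n, 'k) mpoly set" where
  "leading_ideal lt I = Idl\<^bsub>polyring\<^esub> (leading_part lt ` I)"

text \<open>
  The quotient ring \<open>k[X]/I\<close> as a \<open>k\<close>-algebra: a scalar \<open>c\<close> acts as multiplication by the class
  of the constant polynomial \<open>c\<close>.
\<close>

definition quotient_algebra ::
    "('n, 'k::comm_ring_1) mpoly set \<Rightarrow> ('k, ('n, 'k) mpoly set) module" where
  "quotient_algebra I =
     \<lparr>carrier = carrier (polyring Quot I), mult = mult (polyring Quot I),
      one = one (polyring Quot I), zero = zero (polyring Quot I), add = add (polyring Quot I),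
      smult = (\<lambda>c A. (I +>\<^bsub>polyring\<^esub> Poly_Mapping.single 0 c) \<otimes>\<^bsub>polyring Quot I\<^esub> A)\<rparr>"

text \<open>
  The degree \<open>t\<close> component of \<open>k[X]/I\<close> consists of the classes of the homogeneous polynomials of
  degree \<open>t\<close>; it is viewed as a \<open>k\<close>-vector space (the fields \<^const>\<open>mult\<close> and \<^const>\<open>one\<close> of the
  record play no role here).
\<close>

definition quotient_component ::
    "('n::finite, 'k::comm_ring_1) mpoly set \<Rightarrow> nat \<Rightarrow> ('k, ('n, 'k) mpoly set) module" where
  "quotient_component I t =
     (quotient_algebra I)\<lparr>carrier := (\<lambda>f. I +>\<^bsub>polyring\<^esub> f) ` homogeneous_polys t\<rparr>"

text \<open>
  \<^const>\<open>vectorspace.dim\<close> is meaningful only for finite-dimensional spaces; for an ideal \<open>I\<close> every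
  \<^term>\<open>quotient_component I t\<close> is one, being spanned by the classes of the monomials of degree \<open>t\<close>.
\<close>

definition hilbert_series :: "(nat \<Rightarrow> ('k::field, 'v) module) \<Rightarrow> int fps" where
  "hilbert_series R = Abs_fps (\<lambda>t. int (vectorspace.dim class_ring (R t)))"

end

(* In each degree t, refine < to an injective ranking of the finitely many monomials of degree t.
   For any ideal J, the classes of the monomials that are not the top-ranked monomial of a degree-t
   element of J form a basis of (k[X]/J)_t. Passing from I to L_<(I) does not change the set of
   top-ranked monomials: the top incomparability class of an element of L_<(I) of degree t always
   occurs as the top class of an element of I of degree t. *)

theory Submission
  imports Defs
begin

section \<open>Ideals, cosets and quotient components\<close>

lemma polyring_idealD:
  fixes J :: "('n, 'k::comm_ring_1) mpoly set"
  assumes "ideal J polyring"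
  shows "0 \<in> J" "f \<in> J \<Longrightarrow> g \<in> J \<Longrightarrow> f + g \<in> J" "f \<in> J \<Longrightarrow> - f \<in> J"
    "f \<in> J \<Longrightarrow> g \<in> J \<Longrightarrow> f - g \<in> J" "f \<in> J \<Longrightarrow> p * f \<in> J"
proof -
  interpret ideal J polyring by fact
  show "0 \<in> J" using zero_closed by simp
  show add: "f \<in> J \<Longrightarrow> g \<in> J \<Longrightarrow> f + g \<in> J" for f g
    using a_closed by simp
  show mult: "f \<in> J \<Longrightarrow> p * f \<in> J" for f p
    using I_l_closed by simp
  show uminus: "f \<in> J \<Longrightarrow> - f \<in> J" for f
    using mult[of f "-1"] by simp
  show "f \<in> J \<Longrightarrow> g \<in> J \<Longrightarrow> f - g \<in> J"
    using add[of f "- g"] uminus by simp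
qed

lemma polyring_idealI:
  fixes J :: "('n, 'k::comm_ring_1) mpoly set"
  assumes "0 \<in> J" "\<And>f g. f \<in> J \<Longrightarrow> g \<in> J \<Longrightarrow> f + g \<in> J" "\<And>f p. f \<in> J \<Longrightarrow> p * f \<in> J"
  shows "ideal J polyring"
proof (rule idealI)
  show "ring (polyring :: ('n, 'k) mpoly ring)" by (rule class_ring.ring_axioms)
  have uminus: "- f \<in> J" if "f \<in> J" for f using assms(3)[OF that, of "- 1"] by simp
  show "subgroup J (add_monoid polyring)"
  proof (rule group.subgroupI)
    show "Group.group (add_monoid (polyring :: ('n, 'k) mpoly ring))"
      using class_ring.ring_axioms abelian_group.a_group ring.is_abelian_group by blast
    show "inv\<^bsub>add_monoid polyring\<^esub> f \<in> J" if "f \<in> J" for f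
      using uminus[OF that] class_ring_simps(8)[THEN fun_cong, of f] unfolding a_inv_def by simp
  qed (use assms in auto)
qed (use assms in \<open>auto simp: mult.commute\<close>)

lemma polyring_coset_eq_iff:
  fixes J :: "('n, 'k::comm_ring_1) mpoly set"
  assumes "ideal J polyring"
  shows "J +>\<^bsub>polyring\<^esub> f = J +>\<^bsub>polyring\<^esub> g \<longleftrightarrow> f - g \<in> J"
proof
  note J = polyring_idealD[OF assms]
  have mem: "x \<in> J +>\<^bsub>polyring\<^esub> h \<longleftrightarrow> x - h \<in> J" for x h
    by (auto simp: a_r_coset_def' intro!: bexI[of _ "x - h"])
  {
    assume "J +>\<^bsub>polyring\<^esub> f = J +>\<^bsub>polyring\<^esub> g"
    then show "f - g \<in> J" using mem[of f f] mem[of f g] J(1) by simp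
  next
    assume fg: "f - g \<in> J"
    have "(x - f) + (f - g) = x - g" "(x - g) - (f - g) = x - f" for x
      by simp_all
    then have "x - f \<in> J \<longleftrightarrow> x - g \<in> J" for x
      using J(2)[OF _ fg] J(4)[OF _ fg] by metis
    then show "J +>\<^bsub>polyring\<^esub> f = J +>\<^bsub>polyring\<^esub> g" using mem by blast
  }
qed

text \<open>Lets all later computations in a graded component run on polynomial representatives of
  the cosets.\<close>

lemma quotient_component_simps:
  fixes J :: "('n::finite, 'k::comm_ring_1) mpoly set"
  assumes "ideal J polyring"
  shows "carrier (quotient_component J t) = (\<lambda>f. J +>\<^bsub>polyring\<^esub> f) ` homogeneous_polys t"
    and "(J +>\<^bsub>polyring\<^esub> f) \<oplus>\<^bsub>quotient_component J t\<^esub> (J +>\<^bsub>polyring\<^esub> g) = J +>\<^bsub>polyring\<^esub> (f + g)"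
    and "\<zero>\<^bsub>quotient_component J t\<^esub> = J +>\<^bsub>polyring\<^esub> 0"
    and "c \<odot>\<^bsub>quotient_component J t\<^esub> (J +>\<^bsub>polyring\<^esub> f) = J +>\<^bsub>polyring\<^esub> (Poly_Mapping.single 0 c * f)"
proof -
  interpret ideal J polyring by fact
  show "(J +>\<^bsub>polyring\<^esub> f) \<oplus>\<^bsub>quotient_component J t\<^esub> (J +>\<^bsub>polyring\<^esub> g) = J +>\<^bsub>polyring\<^esub> (f + g)"
    using a_rcos_sum[of f g] by (simp add: quotient_component_def quotient_algebra_def FactRing_def)
  show "\<zero>\<^bsub>quotient_component J t\<^esub> = J +>\<^bsub>polyring\<^esub> 0"
    by (auto simp: quotient_component_def quotient_algebra_def FactRing_def a_r_coset_def')
  show "c \<odot>\<^bsub>quotient_component J t\<^esub> (J +>\<^bsub>polyring\<^esub> f) = J +>\<^bsub>polyring\<^esub> (Poly_Mapping.single 0 c * f)"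
    using rcoset_mult_add[of "Poly_Mapping.single 0 c" f]
    by (simp add: quotient_component_def quotient_algebra_def FactRing_def)
qed (simp add: quotient_component_def)

section \<open>Coefficients, supports and degrees\<close>

text \<open>By cancellation, \<open>d\<close> is the only exponent of \<open>f\<close> that can
  contribute to the coefficient at \<open>c + d\<close>.\<close>

lemma lookup_single_times:
  fixes f :: "('a::cancel_comm_monoid_add) \<Rightarrow>\<^sub>0 ('k::comm_semiring_1)"
  shows "Poly_Mapping.lookup (Poly_Mapping.single c k * f) (c + d) = k * Poly_Mapping.lookup f d"
proof -
  have "Poly_Mapping.lookup (Poly_Mapping.single c k * f) (c + d) =
    Sum_any (\<lambda>l. (k when c = l) * Sum_any (\<lambda>q. Poly_Mapping.lookup f q when c + d = l + q))"
    by (simp only: lookup_mult lookup_single)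
  also have "\<dots> = Sum_any (\<lambda>l. k * Sum_any (\<lambda>q. Poly_Mapping.lookup f q when d = q) when l = c)"
    by (intro Sum_any.cong) (auto simp: when_def)
  finally show ?thesis by simp
qed

lemma keys_single_times:
  fixes f :: "('a::cancel_comm_monoid_add) \<Rightarrow>\<^sub>0 ('k::comm_semiring_1)"
  shows "Poly_Mapping.keys (Poly_Mapping.single c k * f) \<subseteq> (\<lambda>d. c + d) ` Poly_Mapping.keys f"
proof
  fix b
  assume "b \<in> Poly_Mapping.keys (Poly_Mapping.single c k * f)"
  with keys_mult[of "Poly_Mapping.single c k" f]
  obtain a d where ad: "a \<in> Poly_Mapping.keys (Poly_Mapping.single c k)" "d \<in> Poly_Mapping.keys f" "b = a + d"
    by blast
  then have "a = c" by (metis empty_iff keys_single singletonD)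
  with ad show "b \<in> (\<lambda>d. c + d) ` Poly_Mapping.keys f" by blast
qed

lemma lookup_sum_single:
  assumes "finite A"
  shows "Poly_Mapping.lookup (\<Sum>a\<in>A. Poly_Mapping.single a (c a)) b = (if b \<in> A then c b else 0)"
  using assms by (simp add: lookup_sum lookup_single when_def)

lemma poly_mapping_sum_single:
  "(\<Sum>a\<in>Poly_Mapping.keys f. Poly_Mapping.single a (Poly_Mapping.lookup f a)) = f"
  by (rule poly_mapping_eqI) (simp add: lookup_sum_single in_keys_iff)

lemma expo_deg_add: "expo_deg (a + b) = expo_deg a + expo_deg b"
  by (simp add: expo_deg_def lookup_add sum.distrib)

lemma finite_expo_deg: "finite {a :: 'n::finite expo. expo_deg a = t}" (is "finite ?A")
proof (rule finite_imageD)
  have "Poly_Mapping.lookup a \<in> UNIV \<rightarrow>\<^sub>E {..t}" if "a \<in> ?A" for a :: "'n expo"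
  proof (rule PiE_I)
    fix i
    have "Poly_Mapping.lookup a i \<le> expo_deg a"
      unfolding expo_deg_def by (rule member_le_sum) simp_all
    with that show "Poly_Mapping.lookup a i \<in> {..t}" by simp
  qed simp
  then have "Poly_Mapping.lookup ` ?A \<subseteq> UNIV \<rightarrow>\<^sub>E {..t}" by blast
  then show "finite (Poly_Mapping.lookup ` ?A)"
    by (rule finite_subset) (simp add: finite_PiE)
  show "inj_on Poly_Mapping.lookup ?A"
    by (rule inj_onI) (rule poly_mapping_eqI, simp only:)
qed

lemma lookup_homogeneous_component:
  "Poly_Mapping.lookup (homogeneous_component t f) a =
     (if expo_deg a = t then Poly_Mapping.lookup f a else 0)"
  unfolding homogeneous_component_def by (subst lookup_sum_single) (auto simp: in_keys_iff)

lemma lookup_leading_part: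
  "Poly_Mapping.lookup (leading_part lt f) a =
     (if \<forall>b\<in>Poly_Mapping.keys f. \<not> lt a b then Poly_Mapping.lookup f a else 0)"
  unfolding leading_part_def by (subst lookup_sum_single) (auto simp: in_keys_iff)

lemma homogeneous_polys_closed:
  fixes f g :: "('n::finite, 'k::comm_ring_1) mpoly"
  shows "0 \<in> (homogeneous_polys t :: ('n, 'k) mpoly set)"
    and "f \<in> homogeneous_polys t \<Longrightarrow> g \<in> homogeneous_polys t \<Longrightarrow> f + g \<in> homogeneous_polys t"
    and "f \<in> homogeneous_polys t \<Longrightarrow> Poly_Mapping.single 0 c * f \<in> homogeneous_polys t"
proof -
  show "f \<in> homogeneous_polys t \<Longrightarrow> g \<in> homogeneous_polys t \<Longrightarrow> f + g \<in> homogeneous_polys t"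
    using keys_add[of f g] by (auto simp: homogeneous_polys_def)
  show "f \<in> homogeneous_polys t \<Longrightarrow> Poly_Mapping.single 0 c * f \<in> homogeneous_polys t"
    using keys_single_times[of 0 c f] by (auto simp: homogeneous_polys_def)
qed (simp add: homogeneous_polys_def)

text \<open>The axioms descend from polynomial arithmetic, because
  \<open>homogeneous_polys t\<close> is closed under sums and scalars. This opens the theory of
  bases and dimension to the graded components.\<close>

lemma vectorspace_quotient_component:
  fixes J :: "('n::finite, 'k::field) mpoly set"
  assumes "ideal J polyring"
  shows "vectorspace class_ring (quotient_component J t)"
proof -
  let ?Q = "quotient_component J t"
  note Q = quotient_component_simps[OF assms]
  note H = homogeneous_polys_closed
  have grp: "abelian_group ?Q"
  proof (rule abelian_groupI)
    fix x assume "x \<in> carrier ?Q"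
    then obtain f where f: "f \<in> homogeneous_polys t" "x = J +>\<^bsub>polyring\<^esub> f" by (auto simp: Q)
    have "(J +>\<^bsub>polyring\<^esub> (Poly_Mapping.single 0 (- 1) * f)) \<oplus>\<^bsub>?Q\<^esub> x = \<zero>\<^bsub>?Q\<^esub>"
      by (simp add: f Q single_uminus)
    then show "\<exists>y\<in>carrier ?Q. y \<oplus>\<^bsub>?Q\<^esub> x = \<zero>\<^bsub>?Q\<^esub>"
      using H(3)[OF f(1)] by (auto simp: Q(1))
  qed (auto simp: Q H add_ac)
  have "module class_ring ?Q"
  proof (rule moduleI[OF class_cring.is_cring grp])
    have "Poly_Mapping.single 0 (a * b) = Poly_Mapping.single (0::'n expo) a * Poly_Mapping.single 0 b"
      for a b :: 'k
      by (simp add: mult_single)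
    then show "(a \<otimes>\<^bsub>class_ring\<^esub> b) \<odot>\<^bsub>?Q\<^esub> x = a \<odot>\<^bsub>?Q\<^esub> (b \<odot>\<^bsub>?Q\<^esub> x)"
      if "x \<in> carrier ?Q" for a b x
      using that by (auto simp: Q mult.assoc)
    show "a \<odot>\<^bsub>?Q\<^esub> x \<in> carrier ?Q" if "x \<in> carrier ?Q" for a x
      using that by (auto simp: Q H)
    show "(a \<oplus>\<^bsub>class_ring\<^esub> b) \<odot>\<^bsub>?Q\<^esub> x = a \<odot>\<^bsub>?Q\<^esub> x \<oplus>\<^bsub>?Q\<^esub> b \<odot>\<^bsub>?Q\<^esub> x"
      if "x \<in> carrier ?Q" for a b x
      using that by (auto simp: Q single_add distrib_right)
    show "a \<odot>\<^bsub>?Q\<^esub> (x \<oplus>\<^bsub>?Q\<^esub> y) = a \<odot>\<^bsub>?Q\<^esub> x \<oplus>\<^bsub>?Q\<^esub> a \<odot>\<^bsub>?Q\<^esub> y"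
      if "x \<in> carrier ?Q" "y \<in> carrier ?Q" for a x y
      using that by (auto simp: Q distrib_left)
  qed (auto simp: Q)
  then show ?thesis
    by (simp add: vectorspace_def class_field)
qed

section \<open>Weak orders and compatible rankings\<close>

text \<open>The last claim, negative transitivity, is the form in which transitivity of
  incomparability gets used. If \<open>lt a c\<close> held, then \<open>lt b a\<close> would give
  \<open>lt b c\<close>, and \<open>lt c b\<close> would give \<open>lt a b\<close>; so
  \<open>b\<close> would be incomparable to both \<open>a\<close> and \<open>c\<close>, making these
  two incomparable.\<close>

lemma weak_orderD:
  assumes "weak_order lt"
  shows "\<not> lt a a" "lt a b \<Longrightarrow> lt b c \<Longrightarrow> lt a c"
    "\<not> lt a b \<Longrightarrow> \<not> lt b c \<Longrightarrow> \<not> lt a c"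
proof -
  from assms have irrefl: "\<not> lt x x" and trans: "lt x y \<Longrightarrow> lt y z \<Longrightarrow> lt x z"
    and equiv: "equivp (\<lambda>a b. \<not> lt a b \<and> \<not> lt b a)" for x y z
    unfolding weak_order_def irreflp_def transp_def by blast+
  show "\<not> lt a a" "lt a b \<Longrightarrow> lt b c \<Longrightarrow> lt a c" by (fact irrefl trans)+
  assume "\<not> lt a b" "\<not> lt b c"
  then show "\<not> lt a c"
    using trans[of a c b] trans[of b a c] equivp_transp[OF equiv, of a b c] by blast
qed

text \<open>Elements are ranked first by their number of strict predecessors in \<open>M\<close>; an
  arbitrary enumeration breaks the ties.\<close>

lemma weak_order_rank:
  assumes "weak_order lt" "finite M"
  obtains \<rho> :: "'a \<Rightarrow> nat" where "inj_on \<rho> M" "\<And>a b. a \<in> M \<Longrightarrow> b \<in> M \<Longrightarrow> lt a b \<Longrightarrow> \<rho> a < \<rho> b"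
proof -
  obtain \<phi> :: "'a \<Rightarrow> nat" and n where \<phi>: "\<phi> ` M = {i. i < n}" "inj_on \<phi> M"
    using finite_imp_inj_to_nat_seg[OF assms(2)] by blast
  define below where "below a = card {b \<in> M. lt b a}" for a
  define \<rho> where "\<rho> a = below a * n + \<phi> a" for a
  have \<phi>_less: "\<phi> a < n" if "a \<in> M" for a
    using \<phi>(1) that by blast
  \<comment> \<open>The remainder modulo \<open>n\<close> recovers the tie-break, so
    \<open>\<rho>\<close> inherits injectivity from \<open>\<phi>\<close>.\<close>
  have "\<rho> a mod n = \<phi> a" if "a \<in> M" for a
    using \<phi>_less[OF that] by (simp add: \<rho>_def)
  then have "inj_on \<rho> M"
    using \<phi>(2) by (metis inj_onD inj_onI)
  moreover have "\<rho> a < \<rho> b" if "a \<in> M" "b \<in> M" "lt a b" for a b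
  proof -
    have "{c \<in> M. lt c a} \<subset> {c \<in> M. lt c b}"
      using that weak_orderD(1,2)[OF assms(1)] by blast
    \<comment> \<open>One more predecessor raises the rank by \<open>n\<close>, which outweighs
      every tie-break, as \<open>\<phi>\<close> stays below \<open>n\<close> on
      \<open>M\<close>.\<close>
    then have "Suc (below a) \<le> below b"
      unfolding below_def using assms(2) by (simp add: Suc_le_eq psubset_card_mono)
    then have "Suc (below a) * n \<le> below b * n" by (rule mult_le_mono1)
    with \<phi>_less[OF that(1)] show ?thesis by (simp add: \<rho>_def)
  qed
  ultimately show thesis by (rule that)
qed

section \<open>Leading exponents and standard polynomials\<close>

text \<open>For \<open>\<rho>\<close> injective on \<open>M\<close>, these are the leading exponents
  in the sense of Groebner bases. Restricting supports to \<open>M\<close> allows working in one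
  degree, where a ranking by natural numbers exists.\<close>

definition lead_exponents ::
    "('n expo \<Rightarrow> nat) \<Rightarrow> 'n expo set \<Rightarrow> ('n, 'k::comm_ring_1) mpoly set \<Rightarrow> 'n expo set" where
  "lead_exponents \<rho> M J =
     {a \<in> M. \<exists>f\<in>J. Poly_Mapping.keys f \<subseteq> M \<and> a \<in> Poly_Mapping.keys f \<and>
       (\<forall>b\<in>Poly_Mapping.keys f. \<rho> b \<le> \<rho> a)}"

text \<open>Division with remainder by \<open>J\<close>, by induction on a strict bound
  \<open>n\<close> for the ranks in the support: the top term is either cancelled by an element of
  \<open>J\<close> or moved into the remainder.\<close>

lemma standard_representative:
  fixes J :: "('n, 'k::field) mpoly set"
  assumes J: "ideal J polyring" and inj: "inj_on \<rho> M" and f: "Poly_Mapping.keys f \<subseteq> M"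
  obtains s where "Poly_Mapping.keys s \<subseteq> M - lead_exponents \<rho> M J" "f - s \<in> J"
proof -
  have "\<exists>s. Poly_Mapping.keys s \<subseteq> M - lead_exponents \<rho> M J \<and> f - s \<in> J"
    if "Poly_Mapping.keys f \<subseteq> {a \<in> M. \<rho> a < n}" for f n
    using that
  proof (induction n arbitrary: f)
    case 0
    then have "f = 0" by simp
    then show ?case using polyring_idealD(1)[OF J] by (intro exI[of _ 0]) simp
  next
    case (Suc n)
    show ?case
    proof (cases "\<exists>a\<in>Poly_Mapping.keys f. \<rho> a = n")
      case False
      have "\<rho> b < n" if "b \<in> Poly_Mapping.keys f" for b
        using that False Suc.prems by (metis (no_types, lifting) less_SucE mem_Collect_eq subsetD)
      with Suc.prems Suc.IH[of f] show ?thesis by blast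
    next
      case True
      then obtain a where a: "a \<in> Poly_Mapping.keys f" "\<rho> a = n" by blast
      have aM: "a \<in> M" using a(1) Suc.prems by blast
      let ?c = "Poly_Mapping.lookup f a"
      \<comment> \<open>Shared by both cases: by injectivity \<open>a\<close> is the only exponent
        of rank \<open>n\<close>, so subtracting any \<open>h\<close> with the right coefficient at
        \<open>a\<close> lowers the rank bound.\<close>
      have cancel: "\<exists>s. Poly_Mapping.keys s \<subseteq> M - lead_exponents \<rho> M J \<and> f - h - s \<in> J"
        if h: "Poly_Mapping.keys h \<subseteq> {b \<in> M. \<rho> b \<le> n}" "Poly_Mapping.lookup h a = ?c" for h
      proof (rule Suc.IH, rule subsetI)
        fix b assume b: "b \<in> Poly_Mapping.keys (f - h)"
        then have "b \<in> Poly_Mapping.keys f \<or> b \<in> Poly_Mapping.keys h"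
          by (auto simp: in_keys_iff lookup_minus)
        then have bM: "b \<in> M" "\<rho> b \<le> n" using h(1) Suc.prems by auto
        have "b \<noteq> a" using b h(2) by (auto simp: in_keys_iff lookup_minus)
        with bM a(2) aM inj have "\<rho> b \<noteq> n" by (auto dest: inj_onD)
        with bM show "b \<in> {b \<in> M. \<rho> b < n}" by simp
      qed
      show ?thesis
      proof (cases "a \<in> lead_exponents \<rho> M J")
        case True
        then obtain g where g: "g \<in> J" "Poly_Mapping.keys g \<subseteq> M" "a \<in> Poly_Mapping.keys g"
          "\<forall>b\<in>Poly_Mapping.keys g. \<rho> b \<le> \<rho> a"
          by (auto simp: lead_exponents_def)
        \<comment> \<open>Over a field, \<open>g\<close> can be rescaled to match the coefficient of
          \<open>f\<close> at \<open>a\<close>.\<close>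
        define h where "h = Poly_Mapping.single 0 (?c / Poly_Mapping.lookup g a) * g"
        have lookup_h: "Poly_Mapping.lookup h b = ?c / Poly_Mapping.lookup g a * Poly_Mapping.lookup g b" for b
          using lookup_single_times[of 0 _ g b] by (simp add: h_def)
        have hJ: "h \<in> J" unfolding h_def by (rule polyring_idealD(5)[OF J g(1)])
        have "Poly_Mapping.keys h \<subseteq> Poly_Mapping.keys g"
          by (auto simp: in_keys_iff lookup_h)
        then have "Poly_Mapping.keys h \<subseteq> {b \<in> M. \<rho> b \<le> n}" using g(2,4) a(2) by blast
        moreover have "Poly_Mapping.lookup h a = ?c"
          using g(3) by (simp add: lookup_h in_keys_iff)
        ultimately obtain s where s: "Poly_Mapping.keys s \<subseteq> M - lead_exponents \<rho> M J" "f - h - s \<in> J"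
          using cancel by blast
        have "f - s = (f - h - s) + h" by simp
        then have "f - s \<in> J" using polyring_idealD(2)[OF J s(2) hJ] by simp
        with s(1) show ?thesis by blast
      next
        case False
        have "Poly_Mapping.keys (Poly_Mapping.single a ?c) \<subseteq> {b \<in> M. \<rho> b \<le> n}"
          using aM a(2) by simp
        then obtain s where s: "Poly_Mapping.keys s \<subseteq> M - lead_exponents \<rho> M J"
          "f - Poly_Mapping.single a ?c - s \<in> J"
          using cancel[of "Poly_Mapping.single a ?c"] by auto
        have "Poly_Mapping.keys (Poly_Mapping.single a ?c + s) \<subseteq> M - lead_exponents \<rho> M J"
          using keys_add[of "Poly_Mapping.single a ?c" s] s(1) aM False by (auto split: if_splits)
        with s(2) show ?thesis by (metis diff_diff_eq)
      qed
    qed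
  qed
  \<comment> \<open>For \<open>f = 0\<close> the maximum is unspecified, but the inclusion is then
    vacuous.\<close>
  moreover have "Poly_Mapping.keys f \<subseteq> {a \<in> M. \<rho> a < Suc (Max (\<rho> ` Poly_Mapping.keys f))}"
    using f by (auto simp: less_Suc_eq_le)
  ultimately show thesis using that by blast
qed

text \<open>Otherwise an exponent of maximal rank in the support of \<open>s\<close> would be a
  leading exponent of \<open>J\<close>. This yields uniqueness of remainders.\<close>

lemma standard_polynomial_eq_0:
  assumes "s \<in> J" "Poly_Mapping.keys s \<subseteq> M - lead_exponents \<rho> M J"
  shows "s = 0"
proof (rule ccontr)
  assume "s \<noteq> 0"
  then have "Poly_Mapping.keys s \<noteq> {}" by simp
  then have "Max (\<rho> ` Poly_Mapping.keys s) \<in> \<rho> ` Poly_Mapping.keys s" by (intro Max_in) simp_all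
  then obtain a where a: "a \<in> Poly_Mapping.keys s" "\<rho> a = Max (\<rho> ` Poly_Mapping.keys s)"
    by (metis imageE)
  then have "\<forall>b\<in>Poly_Mapping.keys s. \<rho> b \<le> \<rho> a" by simp
  with a(1) assms have "a \<in> lead_exponents \<rho> M J"
    unfolding lead_exponents_def by blast
  with a(1) assms(2) show False by blast
qed

section \<open>Top slices and the leading ideal\<close>

text \<open>
  Polynomials each of whose degree-and-incomparability-class slices is the top slice of a
  homogeneous element of \<open>I\<close> (or zero).
\<close>

definition class_leading_polys ::
    "('n::finite expo \<Rightarrow> 'n expo \<Rightarrow> bool) \<Rightarrow> ('n, 'k::comm_ring_1) mpoly set \<Rightarrow> ('n, 'k) mpoly set" where
  "class_leading_polys lt I = {g. \<forall>a. \<exists>f\<in>I.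
     (\<forall>b\<in>Poly_Mapping.keys f. expo_deg b = expo_deg a \<and> \<not> lt a b) \<and>
     (\<forall>b. expo_deg b = expo_deg a \<and> \<not> lt a b \<and> \<not> lt b a \<longrightarrow>
       Poly_Mapping.lookup f b = Poly_Mapping.lookup g b)}"

text \<open>Translation by \<open>c\<close> preserves and reflects \<open>lt\<close> and shifts
  degrees uniformly, so it carries slices into slices and a witness can be multiplied by the same
  term.\<close>

lemma single_times_class_leading_polys:
  assumes lt: "monomial_preorder lt" and I: "ideal I polyring" and g: "g \<in> class_leading_polys lt I"
  shows "Poly_Mapping.single c k * g \<in> class_leading_polys lt I"
  unfolding class_leading_polys_def
proof (intro CollectI allI)
  fix a
  let ?h = "Poly_Mapping.single c k * g"
  let ?R = "\<lambda>f. (\<forall>b\<in>Poly_Mapping.keys f. expo_deg b = expo_deg a \<and> \<not> lt a b) \<and>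
    (\<forall>b. expo_deg b = expo_deg a \<and> \<not> lt a b \<and> \<not> lt b a \<longrightarrow>
      Poly_Mapping.lookup f b = Poly_Mapping.lookup ?h b)"
  from lt have wo: "weak_order lt" and shift: "lt (c + x) (c + y) \<longleftrightarrow> lt x y" for x y
    by (auto simp: monomial_preorder_def add.commute[of c])
  note lt_trans = weak_orderD(3)[OF wo]
  show "\<exists>f\<in>I. ?R f"
  proof (cases "\<exists>d. expo_deg (c + d) = expo_deg a \<and> \<not> lt a (c + d) \<and> \<not> lt (c + d) a")
    case True
    then obtain d where d: "expo_deg (c + d) = expo_deg a" "\<not> lt a (c + d)" "\<not> lt (c + d) a" by blast
    \<comment> \<open>The witness for \<open>g\<close> is taken at \<open>d\<close>, whose translate
      \<open>c + d\<close> lies in the slice of \<open>a\<close>.\<close>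
    obtain f where f: "f \<in> I" "\<forall>b\<in>Poly_Mapping.keys f. expo_deg b = expo_deg d \<and> \<not> lt d b"
      "\<forall>b. expo_deg b = expo_deg d \<and> \<not> lt d b \<and> \<not> lt b d \<longrightarrow>
        Poly_Mapping.lookup f b = Poly_Mapping.lookup g b"
      using g unfolding class_leading_polys_def by blast
    let ?f = "Poly_Mapping.single c k * f"
    have "expo_deg b = expo_deg a \<and> \<not> lt a b" if "b \<in> Poly_Mapping.keys ?f" for b
    proof -
      from that obtain e where e: "b = c + e" "e \<in> Poly_Mapping.keys f"
        using keys_single_times by blast
      with f(2) have "expo_deg e = expo_deg d" "\<not> lt d e" by auto
      with d show ?thesis unfolding e(1)
        using lt_trans[of a "c + d" "c + e"] by (simp add: expo_deg_add shift)
    qed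
    moreover have "Poly_Mapping.lookup ?f b = Poly_Mapping.lookup ?h b"
      if b: "expo_deg b = expo_deg a" "\<not> lt a b" "\<not> lt b a" for b
    proof (cases "\<exists>e. b = c + e")
      case True
      then obtain e where e: "b = c + e" by blast
      \<comment> \<open>Both exponents are incomparable to \<open>a\<close>, hence to each other;
        cancelling \<open>c\<close> puts \<open>e\<close> in the slice of \<open>d\<close>, where
        \<open>f\<close> and \<open>g\<close> agree.\<close>
      have "\<not> lt (c + d) (c + e)" "\<not> lt (c + e) (c + d)"
        using lt_trans[OF d(3) b(2)] lt_trans[OF b(3) d(2)] e by simp_all
      with b d f(3) have "Poly_Mapping.lookup f e = Poly_Mapping.lookup g e"
        by (simp add: e expo_deg_add shift)
      then show ?thesis by (simp add: e lookup_single_times)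
    next
      case False
      then have "b \<notin> Poly_Mapping.keys ?f" "b \<notin> Poly_Mapping.keys ?h"
        using keys_single_times by blast+
      then show ?thesis by (simp add: in_keys_iff)
    qed
    moreover have "?f \<in> I" by (rule polyring_idealD(5)[OF I f(1)])
    ultimately show ?thesis by blast
  next
    \<comment> \<open>No multiple of x^c lies in the slice of \<open>a\<close>, so the product
      vanishes there and 0 is a witness.\<close>
    case False
    have "Poly_Mapping.lookup ?h b = 0" if b: "expo_deg b = expo_deg a" "\<not> lt a b" "\<not> lt b a" for b
    proof -
      have "b \<notin> Poly_Mapping.keys ?h"
        using keys_single_times[of c k g] False b by blast
      then show ?thesis by (simp add: in_keys_iff)
    qed
    then show ?thesis using polyring_idealD(1)[OF I] by (intro bexI[of _ 0]) simp_all
  qed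
qed

text \<open>Witnesses for one slice can be added, and a general multiplier is split into its terms.
  Being an ideal, this set contains \<open>leading_ideal lt I\<close> as soon as it contains the
  leading parts.\<close>

lemma ideal_class_leading_polys:
  assumes lt: "monomial_preorder lt" and I: "ideal I polyring"
  shows "ideal (class_leading_polys lt I) polyring"
proof (rule polyring_idealI)
  let ?W = "class_leading_polys lt I"
  show zero: "0 \<in> ?W"
    unfolding class_leading_polys_def
    using polyring_idealD(1)[OF I] by (auto intro!: bexI[of _ 0])
  show add: "g + h \<in> ?W" if g: "g \<in> ?W" and h: "h \<in> ?W" for g h
    unfolding class_leading_polys_def
  proof (intro CollectI allI)
    fix a
    let ?S = "\<lambda>f. \<forall>b\<in>Poly_Mapping.keys f. expo_deg b = expo_deg a \<and> \<not> lt a b"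
    obtain f1 where f1: "f1 \<in> I" "?S f1"
      "\<forall>b. expo_deg b = expo_deg a \<and> \<not> lt a b \<and> \<not> lt b a \<longrightarrow>
        Poly_Mapping.lookup f1 b = Poly_Mapping.lookup g b"
      using g unfolding class_leading_polys_def by blast
    obtain f2 where f2: "f2 \<in> I" "?S f2"
      "\<forall>b. expo_deg b = expo_deg a \<and> \<not> lt a b \<and> \<not> lt b a \<longrightarrow>
        Poly_Mapping.lookup f2 b = Poly_Mapping.lookup h b"
      using h unfolding class_leading_polys_def by blast
    have "f1 + f2 \<in> I" by (rule polyring_idealD(2)[OF I f1(1) f2(1)])
    moreover have "?S (f1 + f2)" using f1(2) f2(2) keys_add[of f1 f2] by blast
    ultimately show "\<exists>f\<in>I. ?S f \<and> (\<forall>b. expo_deg b = expo_deg a \<and> \<not> lt a b \<and> \<not> lt b a \<longrightarrow>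
        Poly_Mapping.lookup f b = Poly_Mapping.lookup (g + h) b)"
      using f1(3) f2(3) by (intro bexI[of _ "f1 + f2"]) (simp_all add: lookup_add)
  qed
  show "p * g \<in> ?W" if g: "g \<in> ?W" for g p
  proof -
    have "(\<Sum>c\<in>A. Poly_Mapping.single c (Poly_Mapping.lookup p c) * g) \<in> ?W" if "finite A" for A
      using that
      by (induction A rule: finite_induct)
        (simp_all add: zero add single_times_class_leading_polys[OF lt I g])
    from this[of "Poly_Mapping.keys p"] show ?thesis
      unfolding sum_distrib_right[symmetric] poly_mapping_sum_single by simp
  qed
qed

text \<open>The exponents of a leading part are pairwise incomparable. On a slice that meets this
  class, a homogeneous component of \<open>f\<close> is the witness, which lies in \<open>I\<close>
  by homogeneity; when the class is missed, 0 is.\<close>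

lemma leading_part_class_leading_polys:
  assumes lt: "monomial_preorder lt" and I: "homogeneous_ideal I" and f: "f \<in> I"
  shows "leading_part lt f \<in> class_leading_polys lt I"
  unfolding class_leading_polys_def
proof (intro CollectI allI)
  fix a
  let ?L = "leading_part lt f"
  from lt have "weak_order lt" by (simp add: monomial_preorder_def)
  note lt_trans = weak_orderD(3)[OF this]
  show "\<exists>h\<in>I. (\<forall>b\<in>Poly_Mapping.keys h. expo_deg b = expo_deg a \<and> \<not> lt a b) \<and>
     (\<forall>b. expo_deg b = expo_deg a \<and> \<not> lt a b \<and> \<not> lt b a \<longrightarrow>
       Poly_Mapping.lookup h b = Poly_Mapping.lookup ?L b)"
  proof (cases "\<exists>c\<in>Poly_Mapping.keys ?L. \<not> lt a c \<and> \<not> lt c a")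
    case True
    then obtain c where c: "c \<in> Poly_Mapping.keys ?L" "\<not> lt a c" "\<not> lt c a" by blast
    \<comment> \<open>Negative transitivity through the maximal exponent \<open>c\<close>: nothing
      in \<open>f\<close> lies above \<open>a\<close>.\<close>
    have max: "\<not> lt a b" if "b \<in> Poly_Mapping.keys f" for b
      using c lt_trans[OF c(2), of b] that
      by (auto simp: in_keys_iff lookup_leading_part split: if_splits)
    let ?h = "homogeneous_component (expo_deg a) f"
    have "?h \<in> I" using I f by (simp add: homogeneous_ideal_def)
    moreover have "expo_deg b = expo_deg a \<and> \<not> lt a b" if "b \<in> Poly_Mapping.keys ?h" for b
      using that max[of b] by (auto simp: in_keys_iff lookup_homogeneous_component split: if_splits)
    \<comment> \<open>Nothing in \<open>f\<close> lies above \<open>b\<close> either, so the leading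
      part keeps the full coefficient at \<open>b\<close>.\<close>
    moreover have "Poly_Mapping.lookup ?h b = Poly_Mapping.lookup ?L b"
      if "expo_deg b = expo_deg a" "\<not> lt a b" "\<not> lt b a" for b
      using that max lt_trans[of b a]
      by (auto simp: lookup_homogeneous_component lookup_leading_part)
    ultimately show ?thesis by blast
  next
    case False
    then have "Poly_Mapping.lookup ?L b = 0" if "\<not> lt a b" "\<not> lt b a" for b
      using that by (auto simp: in_keys_iff)
    then show ?thesis
      using I polyring_idealD(1)[of I]
      by (intro bexI[of _ 0]) (simp_all add: homogeneous_ideal_def)
  qed
qed

lemma leading_ideal_properties:
  assumes lt: "monomial_preorder lt" and I: "homogeneous_ideal I"
  shows "ideal (leading_ideal lt I) polyring"
    and "f \<in> I \<Longrightarrow> leading_part lt f \<in> leading_ideal lt I"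
    and "leading_ideal lt I \<subseteq> class_leading_polys lt I"
proof -
  show "ideal (leading_ideal lt I) polyring"
    unfolding leading_ideal_def by (rule ring.genideal_ideal[OF class_ring.ring_axioms]) simp
  show "f \<in> I \<Longrightarrow> leading_part lt f \<in> leading_ideal lt I"
    unfolding leading_ideal_def genideal_def by blast
  have "ideal (class_leading_polys lt I) polyring"
    using I by (intro ideal_class_leading_polys[OF lt]) (simp add: homogeneous_ideal_def)
  then show "leading_ideal lt I \<subseteq> class_leading_polys lt I"
    using leading_part_class_leading_polys[OF lt I] unfolding leading_ideal_def genideal_def by blast
qed

section \<open>Dimension of the graded components\<close>

text \<open>The standard monomials give a basis: division by \<open>J\<close> shows that their
  classes span, and a standard polynomial in \<open>J\<close> being zero shows independence.\<close>

lemma dim_quotient_component: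
  fixes J :: "('n::finite, 'k::field) mpoly set" and t :: nat
  defines "M \<equiv> {a. expo_deg a = t}"
  assumes J: "ideal J polyring" and inj: "inj_on \<rho> M"
  shows "vectorspace.dim class_ring (quotient_component J t) = card (M - lead_exponents \<rho> M J)"
proof -
  let ?Q = "quotient_component J t"
  let ?B = "M - lead_exponents \<rho> M J"
  let ?cls = "\<lambda>f. J +>\<^bsub>polyring\<^esub> f"
  define x where "x a = ?cls (Poly_Mapping.single a 1)" for a
  interpret Q: vectorspace class_ring ?Q by (rule vectorspace_quotient_component[OF J])
  note Qsimps = quotient_component_simps[OF J]
  note cls_eq = polyring_coset_eq_iff[OF J]
  have finB: "finite ?B" unfolding M_def by (rule finite_Diff) (rule finite_expo_deg)
  have hom: "f \<in> homogeneous_polys t \<longleftrightarrow> Poly_Mapping.keys f \<subseteq> M" for f :: "('n, 'k) mpoly"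
    by (auto simp: homogeneous_polys_def M_def)
  have x_carrier: "x a \<in> carrier ?Q" if "a \<in> M" for a
    using that by (auto simp: Qsimps x_def hom)
  have keys_comb: "Poly_Mapping.keys (\<Sum>a\<in>A. Poly_Mapping.single a (c a)) \<subseteq> A"
    if "finite A" for A and c :: "'n expo \<Rightarrow> 'k"
    using that by (auto simp: in_keys_iff lookup_sum_single split: if_splits)
  \<comment> \<open>Distinct standard monomials have distinct classes, so the basis has as many
    elements as \<open>?B\<close>.\<close>
  have inj_x: "inj_on x ?B"
  proof (rule inj_onI)
    fix a b assume ab: "a \<in> ?B" "b \<in> ?B" "x a = x b"
    let ?d = "Poly_Mapping.single a 1 - Poly_Mapping.single b (1 :: 'k)"
    have "?d \<in> J" using ab(3) by (simp add: x_def cls_eq)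
    moreover have "Poly_Mapping.keys ?d \<subseteq> ?B"
      using ab(1,2) keys_diff[of "Poly_Mapping.single a (1 :: 'k)" "Poly_Mapping.single b 1"] by auto
    ultimately have "?d = 0" by (rule standard_polynomial_eq_0)
    then have "Poly_Mapping.lookup ?d a = 0" by simp
    then show "a = b" by (auto simp: lookup_minus lookup_single when_def split: if_splits)
  qed
  \<comment> \<open>Coefficients in \<open>Q.lincomb\<close> are indexed by vectors, here the
    classes \<open>x a\<close>; injectivity of \<open>x\<close> keeps the summands apart.\<close>
  have lincomb: "Q.lincomb c (x ` A) = ?cls (\<Sum>a\<in>A. Poly_Mapping.single a (c (x a)))"
    if "A \<subseteq> ?B" for A c
    using finite_subset[OF that finB] that
  proof (induction A rule: finite_induct)
    case empty
    then show ?case by (simp add: Q.lincomb_def Qsimps)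
  next
    case (insert a A)
    have "x a \<notin> x ` A" using insert.hyps insert.prems inj_x by (auto dest: inj_onD)
    moreover have "x ` insert a A \<subseteq> carrier ?Q" using insert.prems x_carrier by blast
    ultimately have "Q.lincomb c (x ` insert a A) = c (x a) \<odot>\<^bsub>?Q\<^esub> x a \<oplus>\<^bsub>?Q\<^esub> Q.lincomb c (x ` A)"
      using insert.hyps(1) by (simp add: Q.lincomb_insert2)
    also have "c (x a) \<odot>\<^bsub>?Q\<^esub> x a = ?cls (Poly_Mapping.single a (c (x a)))"
      by (simp add: x_def Qsimps mult_single)
    finally show ?case using insert by (simp add: Qsimps)
  qed
  have "\<not> Q.lin_dep (x ` ?B)"
  proof
    assume "Q.lin_dep (x ` ?B)"
    then obtain S c v where S: "finite S" "S \<subseteq> x ` ?B" "Q.lincomb c S = \<zero>\<^bsub>?Q\<^esub>" "v \<in> S" "c v \<noteq> 0"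
      unfolding Q.lin_dep_def by auto
    then obtain A where A: "A \<subseteq> ?B" "S = x ` A" by (auto simp: subset_image_iff)
    obtain a where a: "a \<in> A" "v = x a" using S(4) A(2) by blast
    have fin: "finite A" using finite_subset[OF A(1) finB] .
    let ?s = "\<Sum>a\<in>A. Poly_Mapping.single a (c (x a))"
    have "?s \<in> J" using S(3) by (simp add: A(2) lincomb[OF A(1)] Qsimps(3) cls_eq)
    moreover have "Poly_Mapping.keys ?s \<subseteq> ?B" by (rule subset_trans[OF keys_comb[OF fin] A(1)])
    ultimately have "?s = 0" by (rule standard_polynomial_eq_0)
    then have "Poly_Mapping.lookup ?s a = 0" by simp
    then have "c (x a) = 0" using a(1) by (simp only: lookup_sum_single[OF fin] if_True)
    with a(2) S(5) show False by simp
  qed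
  moreover have "Q.gen_set (x ` ?B)"
  proof
    show "Q.span (x ` ?B) \<subseteq> carrier ?Q"
      using x_carrier by (intro Q.span_is_subset2) blast
    show "carrier ?Q \<subseteq> Q.span (x ` ?B)"
    proof
      fix v assume "v \<in> carrier ?Q"
      then obtain f where f: "Poly_Mapping.keys f \<subseteq> M" "v = ?cls f" by (auto simp: Qsimps hom)
      obtain s where s: "Poly_Mapping.keys s \<subseteq> ?B" "f - s \<in> J"
        using standard_representative[OF J inj f(1)] .
      \<comment> \<open>The coefficients of the remainder \<open>s\<close>, transported from
        exponents to classes.\<close>
      let ?c = "\<lambda>v. Poly_Mapping.lookup s (inv_into ?B x v)"
      have "(\<Sum>a\<in>Poly_Mapping.keys s. Poly_Mapping.single a (?c (x a))) =
        (\<Sum>a\<in>Poly_Mapping.keys s. Poly_Mapping.single a (Poly_Mapping.lookup s a))"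
      proof (rule sum.cong[OF refl])
        fix a assume "a \<in> Poly_Mapping.keys s"
        then have "inv_into ?B x (x a) = a" using s(1) by (intro inv_into_f_f[OF inj_x]) blast
        then show "Poly_Mapping.single a (?c (x a)) = Poly_Mapping.single a (Poly_Mapping.lookup s a)"
          by (simp only:)
      qed
      then have "Q.lincomb ?c (x ` Poly_Mapping.keys s) = ?cls s"
        by (simp add: lincomb[OF s(1)] poly_mapping_sum_single)
      also have "?cls s = ?cls f" using s(2) cls_eq[of f s] by (simp only: simp_thms)
      finally have "v = Q.lincomb ?c (x ` Poly_Mapping.keys s)" by (simp only: f(2))
      moreover have "finite (x ` Poly_Mapping.keys s)" "x ` Poly_Mapping.keys s \<subseteq> x ` ?B"
        using s(1) by (simp, rule image_mono)
      moreover have "?c \<in> x ` Poly_Mapping.keys s \<rightarrow> carrier class_ring" by simp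
      ultimately show "v \<in> Q.span (x ` ?B)" unfolding Q.span_def by blast
    qed
  qed
  moreover have "x ` ?B \<subseteq> carrier ?Q" using x_carrier by blast
  ultimately have "Q.basis (x ` ?B)" unfolding Q.basis_def by blast
  then have "Q.dim = card (x ` ?B)" by (rule Q.dim_basis[OF finite_imageI[OF finB]])
  then show ?thesis by (simp add: card_image[OF inj_x])
qed

section \<open>Comparison of the ideal with its leading ideal\<close>

text \<open>A top-ranked exponent of \<open>f\<close> is \<open>lt\<close>-maximal and survives in
  the leading part. Conversely, the slice of \<open>g\<close> at its top-ranked exponent is the top
  slice of some element of \<open>I\<close>.\<close>

lemma lead_exponents_leading_ideal:
  fixes I :: "('n::finite, 'k::field) mpoly set" and t :: nat
  defines "M \<equiv> {a. expo_deg a = t}"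
  assumes lt: "monomial_preorder lt" and I: "homogeneous_ideal I"
    and \<rho>: "\<And>a b. a \<in> M \<Longrightarrow> b \<in> M \<Longrightarrow> lt a b \<Longrightarrow> \<rho> a < \<rho> b"
  shows "lead_exponents \<rho> M (leading_ideal lt I) = lead_exponents \<rho> M I"
proof (intro equalityI subsetI)
  fix a assume "a \<in> lead_exponents \<rho> M I"
  then obtain f where f: "f \<in> I" "Poly_Mapping.keys f \<subseteq> M" "a \<in> Poly_Mapping.keys f"
    "\<forall>b\<in>Poly_Mapping.keys f. \<rho> b \<le> \<rho> a" and a: "a \<in> M"
    unfolding lead_exponents_def by blast
  have "\<not> lt a b" if "b \<in> Poly_Mapping.keys f" for b
    using \<rho>[of a b] that f(2,4) a by (meson leD subsetD)
  then have "a \<in> Poly_Mapping.keys (leading_part lt f)"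
    using f(3) by (simp add: in_keys_iff lookup_leading_part)
  moreover have "Poly_Mapping.keys (leading_part lt f) \<subseteq> Poly_Mapping.keys f"
    by (auto simp: in_keys_iff lookup_leading_part split: if_splits)
  ultimately show "a \<in> lead_exponents \<rho> M (leading_ideal lt I)"
    using a f(2,4) leading_ideal_properties(2)[OF lt I f(1)] unfolding lead_exponents_def by blast
next
  fix a assume "a \<in> lead_exponents \<rho> M (leading_ideal lt I)"
  then obtain g where g: "g \<in> leading_ideal lt I" "a \<in> Poly_Mapping.keys g"
    "\<forall>b\<in>Poly_Mapping.keys g. \<rho> b \<le> \<rho> a" and a: "a \<in> M"
    unfolding lead_exponents_def by blast
  have "g \<in> class_leading_polys lt I" using g(1) leading_ideal_properties(3)[OF lt I] by blast
  then obtain f where f: "f \<in> I" "\<forall>b\<in>Poly_Mapping.keys f. expo_deg b = expo_deg a \<and> \<not> lt a b"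
    "\<forall>b. expo_deg b = expo_deg a \<and> \<not> lt a b \<and> \<not> lt b a \<longrightarrow>
      Poly_Mapping.lookup f b = Poly_Mapping.lookup g b"
    unfolding class_leading_polys_def by blast
  have "\<not> lt a a" using lt by (simp add: monomial_preorder_def weak_orderD(1))
  with f(3) have "Poly_Mapping.lookup f a = Poly_Mapping.lookup g a" by blast
  then have "a \<in> Poly_Mapping.keys f" using g(2) by (simp add: in_keys_iff)
  moreover have fM: "Poly_Mapping.keys f \<subseteq> M" using f(2) a by (auto simp: M_def)
  \<comment> \<open>Exponents of \<open>f\<close> below \<open>a\<close> have smaller rank because
    \<open>\<rho>\<close> refines \<open>lt\<close>; the others lie in the slice of \<open>a\<close>
    and therefore occur in \<open>g\<close>.\<close>
  moreover have "\<rho> b \<le> \<rho> a" if b: "b \<in> Poly_Mapping.keys f" for b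
  proof (cases "lt b a")
    case True
    moreover have "b \<in> M" using b fM by blast
    ultimately show ?thesis using \<rho>[of b a] a by simp
  next
    case False
    with f(2,3) b have "Poly_Mapping.lookup f b = Poly_Mapping.lookup g b" by blast
    with b have "b \<in> Poly_Mapping.keys g" by (simp add: in_keys_iff)
    then show ?thesis using g(3) by blast
  qed
  ultimately show "a \<in> lead_exponents \<rho> M I"
    unfolding lead_exponents_def using f(1) a by blast
qed

theorem theorem2p10:
  fixes lt :: "('n::finite \<Rightarrow>\<^sub>0 nat) \<Rightarrow> ('n \<Rightarrow>\<^sub>0 nat) \<Rightarrow> bool"
    and I :: "('n, 'k::field) mpoly set"
  assumes "monomial_preorder lt"
    and "homogeneous_ideal I"
  shows "hilbert_series (quotient_component I) =
         hilbert_series (quotient_component (leading_ideal lt I))"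
proof -
  have "vectorspace.dim class_ring (quotient_component I t) =
    vectorspace.dim class_ring (quotient_component (leading_ideal lt I) t)" for t
  proof -
    let ?M = "{a :: 'n expo. expo_deg a = t}"
    \<comment> \<open>A single ranking serves both ideals, so both dimensions count the complement
      of the same set.\<close>
    obtain \<rho> :: "'n expo \<Rightarrow> nat" where \<rho>: "inj_on \<rho> ?M"
      "\<And>a b. a \<in> ?M \<Longrightarrow> b \<in> ?M \<Longrightarrow> lt a b \<Longrightarrow> \<rho> a < \<rho> b"
      using weak_order_rank[of lt ?M] assms(1) finite_expo_deg
      unfolding monomial_preorder_def by blast
    have "lead_exponents \<rho> ?M (leading_ideal lt I) = lead_exponents \<rho> ?M I"
      using assms \<rho>(2) by (rule lead_exponents_leading_ideal)
    moreover have "ideal I polyring" using assms(2) by (simp add: homogeneous_ideal_def)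
    ultimately show ?thesis
      using dim_quotient_component[OF _ \<rho>(1)] leading_ideal_properties(1)[OF assms] by metis
  qed
  then show ?thesis by (simp add: hilbert_series_def)
qed

end
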